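(* Let $A\in\mathbb{R}^{m\times n}$ and $b\in\mathbb{R}^m$ with $m\ge n$, and assume the genericity condition $\widetilde\sigma_n>\sigma_{n+1}$, where $\widetilde\sigma_n$ is the smallest singular value of $A$ and $\sigma_{n+1}$ is the $(n+1)$-st singular value of $[A,\ b]$ (with $\sigma_{n+1}=0$ if $m=n$). Let $x$ be the total least squares solution for $(A,b)$, assume $x\ne 0$, and put $r=b-Ax$. For $\delta A\in\mathbb{R}^{m\times n}$ and $\delta b\in\mathbb{R}^m$ with $\|[\delta A,\ \delta b]\|_F$ sufficiently small, let $x+\delta x$ be the total least squares solution for $(A+\delta A,\,b+\delta b)$. Then $$\frac{\|\delta x\|_2}{\|x\|_2}\ \lesssim\ \left(\frac{\|b\|_2}{\|x\|_2}\left\|(A^{\mathrm T}A-\sigma_{n+1}^2I_n)^{-1}A^{\mathrm T}\right\|_2\right)\frac{\|\delta b\|_2}{\|b\|_2}+\left[\frac{\|A\|_2\|r\|_2}{\|x\|_2}\left\|(A^{\mathrm T}A-\sigma_{n+1}^2I_n)^{-1}\right\|_2+\|A\|_2\left\|(A^{\mathrm T}A-\sigma_{n+1}^2I_n)^{-1}A^{\mathrm T}\right\|_2\right]\frac{\|\delta A\|_2}{\|A\|_2},$$ where $\lesssim$ means that the inequality holds up to an additive error term $\mathcal{O}\left(\|[\delta A,\ \delta b]\|_F^2\right)$ on the right-hand side, as $\|[\delta A,\ \delta b]\|_F\to 0$ with $A,b$ fixed.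
   Context: The total least squares (TLS) problem for $(A,b)$ is $\min\|[E\ f]\|_F$ subject to $b+f\in\mathscr{R}(A+E)$, where $\mathscr{R}$ denotes the range; a TLS solution is an $x$ with $(A+E)x=b+f$ for a minimizing $[E\ f]$. Under the genericity condition $\widetilde\sigma_n>\sigma_{n+1}$ the TLS solution exists, is unique, and equals $x=(A^{\mathrm T}A-\sigma_{n+1}^2I_n)^{-1}A^{\mathrm T}b$. For sufficiently small perturbations the genericity condition still holds for $(A+\delta A,b+\delta b)$, so the perturbed solution is given by the same formula with $A,b,\sigma_{n+1}$ replaced by $A+\delta A$, $b+\delta b$ and the $(n+1)$-st singular value of $[A+\delta A,\ b+\delta b]$ (taken as $0$ if $m=n$). $\|\cdot\|_2$ is the spectral norm for matrices and the Euclidean norm for vectors; $\|\cdot\|_F$ is the Frobenius norm. *)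

theory Defs
  imports "HOL-Analysis.Analysis" "HOL-Library.Multiset"
begin

text \<open>The augmented matrix $[A,\ b]$; its columns are indexed by \<open>'n option\<close>,
  with \<open>None\<close> the index of the column \<open>b\<close>.\<close>

definition append_col :: "real^'n^'m \<Rightarrow> real^'m \<Rightarrow> real^('n option)^'m" where
  "append_col A b = (\<chi> i j. case j of None \<Rightarrow> b $ i | Some k \<Rightarrow> A $ i $ k)"

definition frob_norm :: "real^'n^'m \<Rightarrow> real" where
  "frob_norm A = sqrt (\<Sum>i\<in>UNIV. \<Sum>j\<in>UNIV. (A $ i $ j)\<^sup>2)"

lemma frob_norm_eq_norm: "frob_norm A = norm A"
  by (simp add: frob_norm_def norm_vec_def L2_set_def sum_nonneg)

definition spectral_norm :: "real^'n^'m \<Rightarrow> real" where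
  "spectral_norm A = onorm ((*v) A)"

definition eigenspace :: "real^'n^'n \<Rightarrow> real \<Rightarrow> (real^'n) set" where
  "eigenspace S l = {v. S *v v = l *\<^sub>R v}"

definition eigenvalues :: "real^'n^'n \<Rightarrow> real set" where
  "eigenvalues S = {l. \<exists>v. v \<noteq> 0 \<and> S *v v = l *\<^sub>R v}"

text \<open>The square roots of the eigenvalues of $A^{\mathrm T}A$ with multiplicity. This matrix
  is symmetric, so geometric and algebraic multiplicities agree, the index set of the sum is
  finite, and the multiset has as many elements as \<open>A\<close> has columns.\<close>

definition singular_values_mset :: "real^'n^'m \<Rightarrow> real multiset" where
  "singular_values_mset A =
    (\<Sum>l\<in>eigenvalues (transpose A ** A).
       replicate_mset (dim (eigenspace (transpose A ** A) l)) (sqrt l))"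

text \<open>The $k$-th largest singular value, counted from $k = 1$. An $m \times n$ matrix has
  $\min(m, n)$ singular values; beyond this range the value is \<open>0\<close> by convention.\<close>

definition singular_value :: "real^'n^'m \<Rightarrow> nat \<Rightarrow> real" where
  "singular_value A k =
    (if 1 \<le> k \<and> k \<le> min CARD('m) CARD('n)
     then rev (sorted_list_of_multiset (singular_values_mset A)) ! (k - 1)
     else 0)"

definition tls_feasible ::
    "real^'n^'m \<Rightarrow> real^'m \<Rightarrow> real^'n^'m \<Rightarrow> real^'m \<Rightarrow> bool" where
  "tls_feasible A b E f \<longleftrightarrow> b + f \<in> range ((*v) (A + E))"

definition tls_minimizer ::
    "real^'n^'m \<Rightarrow> real^'m \<Rightarrow> real^'n^'m \<Rightarrow> real^'m \<Rightarrow> bool" where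
  "tls_minimizer A b E f \<longleftrightarrow> tls_feasible A b E f \<and>
    (\<forall>E' f'. tls_feasible A b E' f' \<longrightarrow>
       frob_norm (append_col E f) \<le> frob_norm (append_col E' f'))"

definition tls_solution :: "real^'n^'m \<Rightarrow> real^'m \<Rightarrow> real^'n \<Rightarrow> bool" where
  "tls_solution A b x \<longleftrightarrow> (\<exists>E f. tls_minimizer A b E f \<and> (A + E) *v x = b + f)"

end

theory Submission imports Defs
begin

text \<open>
  A vector \<open>y\<close> is a TLS solution iff it minimizes \<open>\<parallel>b - A y\<parallel>\<^sup>2 / (1 + \<parallel>y\<parallel>\<^sup>2)\<close>, and under the
  genericity condition the minimum is \<open>s = \<sigma>\<^sup>2\<close>. At the minimizer \<open>x\<close>, with residual \<open>r\<close>, one has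
  \<open>A\<^sup>T r = - s x\<close> and more generally \<open>(b - A z) \<bullet> r = s (1 + z \<bullet> x)\<close> for all \<open>z\<close>.
  Subtracting these identities for the perturbed and the unperturbed problem gives, with
  \<open>e = \<delta>b - \<delta>A x\<close> and up to terms of second order,
  \<open>(A\<^sup>T A - s I) \<delta>x = A\<^sup>T e + \<delta>A\<^sup>T r + \<delta>s x\<close> and \<open>\<delta>s (1 + \<parallel>x\<parallel>\<^sup>2) = 2 e \<bullet> r\<close>.
  Since \<open>x\<close> is a multiple of \<open>A\<^sup>T r\<close>, the terms in \<open>e\<close> combine to \<open>A\<^sup>T H e\<close> with an orthogonal \<open>H\<close>
  (a Householder reflection), which yields the stated bound.
\<close>

section \<open>The smallest singular value\<close>

lemma inner_transpose_mult: "(transpose A *v x) \<bullet> y = x \<bullet> (A *v y)"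
  for A :: "real^'n^'m"
  by (simp add: dot_lmul_matrix)

lemma inner_gram: "v \<bullet> ((transpose A ** A) *v v) = (norm (A *v v))\<^sup>2"
  for A :: "real^'n^'m"
  by (metis inner_commute inner_transpose_mult matrix_vector_mul_assoc power2_norm_eq_inner)

text \<open>This replaces differentiation at a minimum: near \<open>t = 0\<close> the linear term
  dominates. Dividing by \<open>\<bar>c\<bar> + 1\<close> gives an explicit \<open>t\<close> that
  works for either sign of \<open>c\<close>, including \<open>c = 0\<close>.\<close>

lemma linear_coeff_zero_if_nonneg:
  fixes a c :: real
  assumes "\<And>t. 0 \<le> 2 * t * a + t\<^sup>2 * c"
  shows "a = 0"
proof (rule ccontr)
  assume "a \<noteq> 0"
  define t where "t = - a / (\<bar>c\<bar> + 1)"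
  have "2 * t * a + t\<^sup>2 * c \<le> 2 * t * a + t\<^sup>2 * (\<bar>c\<bar> + 1)"
    by (intro add_left_mono mult_left_mono) auto
  also have "\<dots> = - (a\<^sup>2 / (\<bar>c\<bar> + 1))"
  proof -
    have "c' = 0 \<or> 2 * (- a / c') * a + (- a / c')\<^sup>2 * c' = - (a\<^sup>2 / c')" for c'
      by (simp add: power2_eq_square field_simps)
    then show ?thesis
      unfolding t_def by (smt (verit))
  qed
  also have "\<dots> < 0"
    using \<open>a \<noteq> 0\<close> by (simp add: add_nonneg_pos)
  finally show False
    using assms[of t] by simp
qed

text \<open>Compactness of the unit sphere in \<open>W\<close> yields a minimizer \<open>v\<close>
  of the quadratic form. Invariance puts the gradient \<open>g = S *v v - l *\<^sub>R v\<close> into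
  \<open>W\<close>, so \<open>v\<close> may be varied along \<open>g\<close>; the first-order
  coefficient \<open>g \<bullet> g\<close> must then vanish. The vector \<open>u\<close> only
  ensures that the sphere in \<open>W\<close> is nonempty.\<close>

lemma rayleigh_minimum:
  fixes S :: "real^'n^'n"
  assumes sym: "transpose S = S" and W: "subspace W" "\<And>w. w \<in> W \<Longrightarrow> S *v w \<in> W"
    and u: "u \<in> W" "u \<noteq> 0"
  obtains v l where "v \<in> W" "v \<noteq> 0" "S *v v = l *\<^sub>R v"
    "\<And>w. w \<in> W \<Longrightarrow> l * (norm w)\<^sup>2 \<le> w \<bullet> (S *v w)"
proof -
  define K where "K = W \<inter> sphere 0 1"
  have "compact K"
    unfolding K_def using closed_subspace[OF W(1)] by (simp add: closed_Int_compact)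
  moreover have "u /\<^sub>R norm u \<in> K"
    using u W(1) by (simp add: K_def subspace_scale)
  moreover have "continuous_on K (\<lambda>w. w \<bullet> (S *v w))"
    by (intro continuous_intros)
  ultimately obtain v where v: "v \<in> K" and vmin: "\<And>w. w \<in> K \<Longrightarrow> v \<bullet> (S *v v) \<le> w \<bullet> (S *v w)"
    using continuous_attains_inf[of K "\<lambda>w. w \<bullet> (S *v w)"] by blast
  define l where "l = v \<bullet> (S *v v)"
  have vW: "v \<in> W" "norm v = 1"
    using v by (auto simp: K_def)
  have min: "l * (norm w)\<^sup>2 \<le> w \<bullet> (S *v w)" if "w \<in> W" for w
  proof (cases "w = 0")
    case False
    then have "w /\<^sub>R norm w \<in> K"
      using that W(1) by (simp add: K_def subspace_scale)
    then have "l \<le> (w \<bullet> (S *v w)) / (norm w)\<^sup>2"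
      using vmin[of "w /\<^sub>R norm w"]
      by (simp add: l_def matrix_vector_mult_scaleR power2_eq_square divide_inverse mult_ac)
    then show ?thesis
      using False by (simp add: field_simps)
  qed simp
  define g where "g = S *v v - l *\<^sub>R v"
  have gW: "g \<in> W"
    unfolding g_def using vW W by (simp add: subspace_diff subspace_scale)
  have symv: "g \<bullet> (S *v v) = v \<bullet> (S *v g)"
    by (metis inner_commute inner_transpose_mult sym)
  have "g \<bullet> g = 0"
  proof (rule linear_coeff_zero_if_nonneg)
    fix t
    have "0 \<le> (v + t *\<^sub>R g) \<bullet> (S *v (v + t *\<^sub>R g)) - l * (norm (v + t *\<^sub>R g))\<^sup>2"
      using min[of "v + t *\<^sub>R g"] vW gW W(1) by (simp add: subspace_add subspace_scale)
    also have "\<dots> = (v \<bullet> (S *v v) - l * (v \<bullet> v)) + 2 * t * (g \<bullet> (S *v v) - l * (g \<bullet> v))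
        + t\<^sup>2 * (g \<bullet> (S *v g) - l * (g \<bullet> g))"
      unfolding power2_norm_eq_inner
      by (simp add: matrix_vector_right_distrib matrix_vector_mult_scaleR inner_add_left
          inner_add_right symv[symmetric] inner_commute[of v g] power2_eq_square algebra_simps)
    also have "v \<bullet> (S *v v) - l * (v \<bullet> v) = 0"
      using vW(2) by (simp add: l_def norm_eq_1)
    also have "g \<bullet> (S *v v) - l * (g \<bullet> v) = g \<bullet> g"
      by (simp add: g_def inner_diff_right)
    finally show "0 \<le> 2 * t * (g \<bullet> g) + t\<^sup>2 * (g \<bullet> (S *v g) - l * (g \<bullet> g))"
      by simp
  qed
  then have "S *v v = l *\<^sub>R v"
    by (simp add: g_def)
  moreover have "v \<noteq> 0"
    using vW(2) by auto
  ultimately show thesis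
    using that vW(1) min by blast
qed

section \<open>Spectral decomposition of symmetric matrices\<close>

lemma eigenspaces_orthogonal:
  fixes S :: "real^'n^'n"
  assumes "transpose S = S" "k \<noteq> l" "v \<in> eigenspace S k" "w \<in> eigenspace S l"
  shows "orthogonal v w"
proof -
  have "k * (v \<bullet> w) = l * (v \<bullet> w)"
    using assms inner_transpose_mult[of S v w] by (simp add: eigenspace_def)
  then show ?thesis
    using assms(2) by (simp add: orthogonal_def)
qed

text \<open>One eigenvector per eigenvalue gives an orthogonal, hence independent, family.
  Finiteness matters because a sum over an infinite index set, as in
  \<open>singular_values_mset\<close>, would take its default value.\<close>

lemma finite_eigenvalues:
  fixes S :: "real^'n^'n"
  assumes "transpose S = S"
  shows "finite (eigenvalues S)"
proof -
  define e where "e l = (SOME v. v \<noteq> 0 \<and> S *v v = l *\<^sub>R v)" for l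
  have e: "e l \<noteq> 0" "S *v e l = l *\<^sub>R e l" if "l \<in> eigenvalues S" for l
    using that someI_ex[of "\<lambda>v. v \<noteq> 0 \<and> S *v v = l *\<^sub>R v"]
    by (auto simp: eigenvalues_def e_def)
  have "inj_on e (eigenvalues S)"
  proof (rule inj_onI)
    fix k l assume "k \<in> eigenvalues S" "l \<in> eigenvalues S" "e k = e l"
    then show "k = l"
      by (metis e scaleR_cancel_right)
  qed
  moreover have "independent (e ` eigenvalues S)"
  proof (rule pairwise_orthogonal_independent)
    show "pairwise orthogonal (e ` eigenvalues S)"
    proof (rule pairwiseI)
      fix v w assume "v \<in> e ` eigenvalues S" "w \<in> e ` eigenvalues S" "v \<noteq> w"
      then obtain k l where "k \<in> eigenvalues S" "v = e k" "l \<in> eigenvalues S" "w = e l" "k \<noteq> l"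
        by blast
      then show "orthogonal v w"
        using e eigenspaces_orthogonal[OF assms, of k l v w] by (simp add: eigenspace_def)
    qed
    show "0 \<notin> e ` eigenvalues S"
      using e by force
  qed
  ultimately show ?thesis
    using independent_bound_general finite_imageD by blast
qed

text \<open>The orthogonal complement of the span of all eigenvectors is invariant, so if it were
  nonzero, the Rayleigh quotient would have a minimizer in it, which is an eigenvector.\<close>

lemma span_eigenspaces:
  fixes S :: "real^'n^'n"
  assumes "transpose S = S"
  shows "span (\<Union>l\<in>eigenvalues S. eigenspace S l) = UNIV"
proof (rule ccontr)
  define U where "U = (\<Union>l\<in>eigenvalues S. eigenspace S l)"
  define W where "W = {w. \<forall>u\<in>U. orthogonal u w}"
  assume "span (\<Union>l\<in>eigenvalues S. eigenspace S l) \<noteq> UNIV"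
  then have "span U \<subset> span UNIV"
    by (auto simp: U_def)
  then obtain w where w: "w \<noteq> 0" "\<And>y. y \<in> span U \<Longrightarrow> orthogonal w y"
    using orthogonal_to_subspace_exists_gen by metis
  have "w \<in> W"
    using w(2) by (simp add: W_def orthogonal_commute span_base)
  moreover have "subspace W"
    unfolding W_def by (rule subspace_orthogonal_to_vectors)
  moreover have "S *v y \<in> W" if "y \<in> W" for y
  proof -
    have "orthogonal u (S *v y)" if "u \<in> U" for u
    proof -
      obtain l where "S *v u = l *\<^sub>R u"
        using \<open>u \<in> U\<close> by (auto simp: U_def eigenspace_def)
      then have "u \<bullet> (S *v y) = l * (u \<bullet> y)"
        by (metis assms inner_scaleR_left inner_transpose_mult)
      then show ?thesis
        using \<open>y \<in> W\<close> \<open>u \<in> U\<close> by (simp add: W_def orthogonal_def)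
    qed
    then show ?thesis
      by (simp add: W_def)
  qed
  ultimately obtain v l where v: "v \<in> W" "v \<noteq> 0" "S *v v = l *\<^sub>R v"
    using rayleigh_minimum[OF assms] w(1) by metis
  then have "v \<in> U"
    by (auto simp: U_def eigenvalues_def eigenspace_def)
  then have "orthogonal v v"
    using v(1) by (simp add: W_def)
  then show False
    using v(2) by (simp add: orthogonal_self)
qed

lemma dim_Union_orthogonal:
  fixes E :: "'b \<Rightarrow> 'a::euclidean_space set"
  assumes "finite I" "\<And>i j v w. i \<in> I \<Longrightarrow> j \<in> I \<Longrightarrow> i \<noteq> j \<Longrightarrow> v \<in> E i \<Longrightarrow> w \<in> E j \<Longrightarrow> orthogonal v w"
  shows "dim (\<Union>i\<in>I. E i) = (\<Sum>i\<in>I. dim (E i))"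
  using assms
proof (induction I rule: finite_induct)
  case (insert i I)
  have "dim (E i \<union> (\<Union>j\<in>I. E j)) = dim (E i) + dim (\<Union>j\<in>I. E j)"
  proof (rule dim_orthogonal_sum)
    fix v w assume "v \<in> E i" "w \<in> (\<Union>j\<in>I. E j)"
    then show "v \<bullet> w = 0"
      using insert.prems[of i _ v w] insert.hyps(2) by (auto simp: orthogonal_def)
  qed
  moreover have "dim (\<Union>j\<in>I. E j) = (\<Sum>j\<in>I. dim (E j))"
    using insert.prems by (intro insert.IH) blast
  ultimately show ?case
    using insert.hyps by simp
qed simp

text \<open>This makes the list of singular values exactly \<open>CARD('n)\<close> long, so that
  positions in it are meaningful.\<close>

lemma sum_dim_eigenspaces:
  fixes S :: "real^'n^'n"
  assumes "transpose S = S"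
  shows "(\<Sum>l\<in>eigenvalues S. dim (eigenspace S l)) = CARD('n)"
proof -
  have "(\<Sum>l\<in>eigenvalues S. dim (eigenspace S l)) = dim (\<Union>l\<in>eigenvalues S. eigenspace S l)"
    using dim_Union_orthogonal[OF finite_eigenvalues[OF assms], of "eigenspace S"]
      eigenspaces_orthogonal[OF assms] by metis
  also have "\<dots> = dim (UNIV :: (real^'n) set)"
    by (metis assms dim_span span_eigenspaces)
  finally show ?thesis
    by simp
qed

lemma transpose_gram: "transpose (transpose A ** A) = transpose A ** A" for A :: "real^'n^'m"
  by (metis matrix_transpose_mul transpose_transpose)

text \<open>The minimum of the Rayleigh quotient of the Gram matrix is its least eigenvalue. From
  here on singular values enter only through this variational description; the cardinality
  assumption keeps the index out of the range where \<open>singular_value\<close> is 0 by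
  convention.\<close>

lemma smallest_singular_value:
  fixes A :: "real^'n^'m"
  assumes "CARD('n) \<le> CARD('m)"
  obtains l v where "singular_value A CARD('n) = sqrt l" "v \<noteq> 0"
    "(norm (A *v v))\<^sup>2 = l * (norm v)\<^sup>2" "\<And>w. l * (norm w)\<^sup>2 \<le> (norm (A *v w))\<^sup>2"
proof -
  let ?S = "transpose A ** A"
  let ?L = "sorted_list_of_multiset (singular_values_mset A)"
  note sym = transpose_gram[of A]
  obtain u l where u: "u \<noteq> 0" "?S *v u = l *\<^sub>R u" and l: "\<And>w. l * (norm w)\<^sup>2 \<le> w \<bullet> (?S *v w)"
  proof (rule rayleigh_minimum[OF sym subspace_UNIV UNIV_I UNIV_I, of "axis undefined 1"])
    show "axis undefined 1 \<noteq> (0 :: real^'n)"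
      by (simp add: axis_eq_0_iff)
  qed blast
  have l_in: "l \<in> eigenvalues ?S"
    using u by (auto simp: eigenvalues_def)
  have l_le: "l \<le> k" if k: "k \<in> eigenvalues ?S" for k
  proof -
    obtain w where w: "w \<noteq> 0" "?S *v w = k *\<^sub>R w"
      using k by (auto simp: eigenvalues_def)
    then have "l * (norm w)\<^sup>2 \<le> k * (norm w)\<^sup>2"
      using l[of w] by (simp add: power2_norm_eq_inner)
    then show ?thesis
      using w(1) by simp
  qed
  \<comment> \<open>Positive multiplicity ensures that each \<open>sqrt k\<close> really occurs in
    the multiset.\<close>
  have dim_pos: "dim (eigenspace ?S k) > 0" if k: "k \<in> eigenvalues ?S" for k
  proof -
    obtain w where "w \<noteq> 0" "w \<in> eigenspace ?S k"
      using k by (auto simp: eigenvalues_def eigenspace_def)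
    then show ?thesis
      using dim_eq_0[of "eigenspace ?S k"] by blast
  qed
  have "set_mset (replicate_mset (dim (eigenspace ?S k)) (sqrt k)) = {sqrt k}"
    if "k \<in> eigenvalues ?S" for k
    using dim_pos[OF that] by (metis less_irrefl set_mset_replicate_mset_subset)
  then have set_L: "set ?L = sqrt ` eigenvalues ?S"
    unfolding singular_values_mset_def set_sorted_list_of_multiset
      set_mset_sum[OF finite_eigenvalues[OF sym]]
    by (simp only: cong: SUP_cong) blast
  have len: "length ?L = CARD('n)"
    using sum_dim_eigenspaces[OF sym]
    by (simp add: singular_values_mset_def size_multiset_sum flip: size_mset)
  have L0: "?L ! 0 = sqrt l"
  proof (rule antisym)
    obtain i where "i < length ?L" "?L ! i = sqrt l"
      using l_in set_L by (metis imageI in_set_conv_nth)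
    then show "?L ! 0 \<le> sqrt l"
      using sorted_nth_mono[OF sorted_sorted_list_of_multiset, of 0 i "singular_values_mset A"] by simp
    have "?L ! 0 \<in> sqrt ` eigenvalues ?S"
      using set_L len by (metis nth_mem zero_less_card_finite)
    then show "sqrt l \<le> ?L ! 0"
      using l_le by auto
  qed
  \<comment> \<open>Position \<open>CARD('n) - 1\<close> of the reversed list is the head of the
    ascending list, since its length is \<open>CARD('n)\<close>.\<close>
  have "singular_value A CARD('n) = sqrt l"
    using assms len L0 by (simp add: singular_value_def rev_nth Suc_leI)
  moreover have "(norm (A *v u))\<^sup>2 = l * (norm u)\<^sup>2"
    using u(2) by (metis inner_gram inner_scaleR_right power2_norm_eq_inner)
  ultimately show thesis
    using that u(1) l by (simp add: inner_gram)
qed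

section \<open>TLS solutions as minimizers of a quotient\<close>

lemma sum_UNIV_option: "(\<Sum>j\<in>UNIV. f j) = f None + (\<Sum>k\<in>UNIV. f (Some k))"
  for f :: "'n::finite option \<Rightarrow> 'a::comm_monoid_add"
  by (simp add: UNIV_option_conv sum.reindex)

lemma append_col_mult:
  fixes A :: "real^'n^'m"
  shows "append_col A b *v z = A *v (\<chi> k. z $ Some k) + (z $ None) *\<^sub>R b"
  by (simp add: vec_eq_iff matrix_vector_mult_def append_col_def sum_UNIV_option)

lemma norm_option_vec:
  fixes z :: "real^('n::finite option)"
  shows "(norm z)\<^sup>2 = (z $ None)\<^sup>2 + (norm (\<chi> k. z $ Some k :: real^'n))\<^sup>2"
  by (simp add: norm_vec_def L2_set_def sum_nonneg sum_UNIV_option)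

lemma norm_append_col:
  fixes A :: "real^'n^'m"
  shows "(norm (append_col A b))\<^sup>2 = (norm A)\<^sup>2 + (norm b)\<^sup>2"
  by (simp add: norm_vec_def L2_set_def sum_nonneg sum_UNIV_option append_col_def sum.distrib)

lemma norm_matrix_vector_mult_le: "norm (A *v v) \<le> norm A * norm v" for A :: "real^'n^'m"
proof -
  have "norm (A *v v) = L2_set (\<lambda>i. A $ i \<bullet> v) UNIV"
    unfolding norm_vec_def by (simp add: matrix_vector_mult_def inner_vec_def L2_set_def)
  also have "\<dots> \<le> L2_set (\<lambda>i. norm (A $ i) * norm v) UNIV"
    unfolding L2_set_def
    by (intro real_sqrt_le_mono sum_mono) (metis Cauchy_Schwarz_ineq2 abs_ge_zero power2_abs power_mono)
  also have "\<dots> = norm A * norm v"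
    by (simp add: norm_vec_def[of A] L2_set_left_distrib)
  finally show ?thesis .
qed

text \<open>The left-hand side is the norm of \<open>append_col E f\<close> applied to the vector
  with entries \<open>- y\<close> and 1. Treating \<open>E\<close> and \<open>f\<close> jointly
  gives the factor that \<open>tls_correction\<close> attains.\<close>

lemma norm_residual_le:
  fixes E :: "real^'n^'m"
  shows "norm (f - E *v y) \<le> norm (append_col E f) * sqrt (1 + (norm y)\<^sup>2)"
proof -
  define z :: "real^('n option)" where "z = (\<chi> j. case j of None \<Rightarrow> 1 | Some k \<Rightarrow> - y $ k)"
  have z: "z $ None = 1" "(\<chi> k. z $ Some k) = - y"
    by (simp_all add: z_def vec_eq_iff)
  have "f - E *v y = append_col E f *v z"
    unfolding append_col_mult z
    by (simp add: vec_eq_iff matrix_vector_mult_def sum_negf)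
  moreover have "norm z = sqrt (1 + (norm y)\<^sup>2)"
    using norm_option_vec[of z] z by (simp add: real_sqrt_unique)
  ultimately show ?thesis
    using norm_matrix_vector_mult_le by metis
qed

lemma spectral_norm_bound: "norm (A *v v) \<le> spectral_norm A * norm v" for A :: "real^'n^'m"
  unfolding spectral_norm_def by (rule onorm[OF matrix_vector_mul_bounded_linear])

lemma spectral_norm_nonneg: "0 \<le> spectral_norm A" for A :: "real^'n^'m"
  unfolding spectral_norm_def by (rule onorm_pos_le[OF matrix_vector_mul_bounded_linear])

lemma spectral_norm_eq_0_iff: "spectral_norm A = 0 \<longleftrightarrow> (\<forall>v. A *v v = 0)" for A :: "real^'n^'m"
  unfolding spectral_norm_def by (rule onorm_eq_0[OF matrix_vector_mul_bounded_linear])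

text \<open>Move the transpose across the inner product in the squared norm and cancel one factor. A
  general bound \<open>B\<close> covers both the spectral norm and the cruder constants used
  later.\<close>

lemma norm_transpose_mult_le:
  fixes A :: "real^'n^'m"
  assumes "\<And>v. norm (A *v v) \<le> B * norm v"
  shows "norm (transpose A *v w) \<le> B * norm w"
proof (cases "transpose A *v w = 0")
  case True
  \<comment> \<open>The degenerate case still needs \<open>0 \<le> B\<close>, obtained by testing
    the hypothesis on a unit vector.\<close>
  have "0 \<le> B * norm (axis undefined 1 :: real^'n)"
    by (rule order_trans[OF norm_ge_zero assms])
  then show ?thesis
    using True by (simp add: norm_axis_1)
next
  case False
  let ?u = "transpose A *v w"
  have "norm ?u * norm ?u = w \<bullet> (A *v ?u)"
    by (metis inner_transpose_mult power2_eq_square power2_norm_eq_inner)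
  also have "\<dots> \<le> norm w * norm (A *v ?u)"
    by (rule norm_cauchy_schwarz)
  also have "\<dots> \<le> norm w * (B * norm ?u)"
    by (intro mult_left_mono assms) simp
  finally show ?thesis
    using False by (simp add: mult_ac del: transpose_matrix_vector)
qed

text \<open>The number \<open>s\<close> is the minimum of the quotient of squared residual by
  \<open>1 + (norm y)\<^sup>2\<close>, multiplied out to avoid division. It is an argument because
  the perturbation analysis compares the minima of two problems.\<close>

definition is_tls :: "real^'n^'m \<Rightarrow> real^'m \<Rightarrow> real \<Rightarrow> real^'n \<Rightarrow> bool" where
  "is_tls A b s y \<longleftrightarrow> (norm (b - A *v y))\<^sup>2 = s * (1 + (norm y)\<^sup>2) \<and>
    (\<forall>z. s * (1 + (norm z)\<^sup>2) \<le> (norm (b - A *v z))\<^sup>2)"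

lemma is_tls_eq: "is_tls A b s y \<Longrightarrow> (norm (b - A *v y))\<^sup>2 = s * (1 + (norm y)\<^sup>2)"
  and is_tls_le: "is_tls A b s y \<Longrightarrow> s * (1 + (norm z)\<^sup>2) \<le> (norm (b - A *v z))\<^sup>2"
  by (auto simp: is_tls_def)

lemma one_plus_norm_sq_pos: "0 < 1 + (norm v)\<^sup>2"
  by (simp add: add_pos_nonneg)

lemma is_tls_nonneg: "is_tls A b s y \<Longrightarrow> 0 \<le> s"
  using one_plus_norm_sq_pos by (metis is_tls_eq zero_le_mult_iff zero_le_power2 not_less)

text \<open>The smallest correction that makes a given \<open>y\<close> solve the system exactly has rank one.\<close>

lemma tls_correction:
  fixes A :: "real^'n^'m"
  obtains E f where "(A + E) *v y = b + f"
    "norm (append_col E f) * sqrt (1 + (norm y)\<^sup>2) = norm (b - A *v y)"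
proof -
  define c where "c = 1 + (norm y)\<^sup>2"
  define r where "r = b - A *v y"
  \<comment> \<open>Jointly, \<open>E\<close> and \<open>f\<close> are the column \<open>r\<close>
    times the row with entries \<open>y\<close> and \<open>- 1\<close>, divided by the squared norm
    \<open>c\<close> of that row.\<close>
  define E :: "real^'n^'m" where "E = (\<chi> i j. r $ i * y $ j / c)"
  define f where "f = - r /\<^sub>R c"
  have c: "c > 0"
    unfolding c_def by (rule one_plus_norm_sq_pos)
  have "E *v y = ((norm y)\<^sup>2 / c) *\<^sub>R r"
    by (simp add: vec_eq_iff E_def matrix_vector_mult_def norm_vec_def L2_set_def sum_nonneg
        power2_eq_square sum_divide_distrib sum_distrib_left sum_distrib_right mult_ac)
  moreover have "(norm y)\<^sup>2 / c = 1 - 1 / c"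
    using c by (simp add: c_def field_simps)
  ultimately have "E *v y = r + f"
    by (simp add: f_def scaleR_diff_left divide_inverse)
  then have "(A + E) *v y = b + f"
    by (simp add: matrix_vector_mult_add_rdistrib r_def)
  moreover have "norm (append_col E f) * sqrt c = norm r"
  proof -
    have "(norm E)\<^sup>2 = (norm r)\<^sup>2 * (norm y)\<^sup>2 / c\<^sup>2"
      by (simp add: E_def norm_vec_def L2_set_def sum_nonneg power_mult_distrib power_divide
          sum_product flip: sum_divide_distrib)
    moreover have "(norm f)\<^sup>2 = (norm r)\<^sup>2 / c\<^sup>2"
      by (simp add: f_def power_mult_distrib divide_inverse power_inverse mult_ac)
    ultimately have "(norm (append_col E f))\<^sup>2 = (norm r)\<^sup>2 * c / c\<^sup>2"
      by (simp add: norm_append_col c_def add_divide_distrib distrib_left)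
    also have "\<dots> = (norm r)\<^sup>2 / c"
      using c by (simp add: power2_eq_square)
    finally have "(norm (append_col E f) * sqrt c)\<^sup>2 = (norm r)\<^sup>2"
      using c by (simp add: power_mult_distrib)
    then show ?thesis
      using c by (simp add: power2_eq_iff_nonneg)
  qed
  ultimately show thesis
    using that by (simp add: c_def r_def)
qed

text \<open>For fixed \<open>z\<close>, the least squared norm of a correction solved by
  \<open>z\<close> is the quotient at \<open>z\<close>: \<open>norm_residual_le\<close> bounds it
  from below and \<open>tls_correction\<close> attains it. What remains is to minimize over
  \<open>z\<close>.\<close>

lemma tls_solution_iff:
  fixes A :: "real^'n^'m"
  shows "tls_solution A b y \<longleftrightarrow> (\<exists>s. is_tls A b s y)"
proof
  define s where "s = (norm (b - A *v y))\<^sup>2 / (1 + (norm y)\<^sup>2)"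
  have lower: "(norm (b - A *v z))\<^sup>2 \<le> (norm (append_col E f))\<^sup>2 * (1 + (norm z)\<^sup>2)"
    if "(A + E) *v z = b + f" for E f z
  proof -
    have "b - A *v z = - (f - E *v z)"
      using that by (simp add: matrix_vector_mult_add_rdistrib algebra_simps)
    then have "norm (b - A *v z) \<le> norm (append_col E f) * sqrt (1 + (norm z)\<^sup>2)"
      using norm_residual_le[of f E z] by (metis norm_minus_cancel)
    then have "(norm (b - A *v z))\<^sup>2 \<le> (norm (append_col E f) * sqrt (1 + (norm z)\<^sup>2))\<^sup>2"
      by (intro power_mono) auto
    then show ?thesis
      by (simp add: power_mult_distrib)
  qed
  {
    assume "tls_solution A b y"
    then obtain E f where "tls_minimizer A b E f" and Ef: "(A + E) *v y = b + f"
      by (auto simp: tls_solution_def)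
    then have min: "norm (append_col E f) \<le> norm (append_col E' f')"
      if "(A + E') *v z = b + f'" for E' f' z
      using that unfolding tls_minimizer_def tls_feasible_def frob_norm_eq_norm
      by (metis rangeI)
    have "s \<le> (norm (append_col E f))\<^sup>2"
      unfolding s_def using lower[OF Ef] by (simp add: divide_le_eq one_plus_norm_sq_pos)
    have "s * (1 + (norm z)\<^sup>2) \<le> (norm (b - A *v z))\<^sup>2" for z
    proof -
      obtain E' f' where Ef': "(A + E') *v z = b + f'"
        and eq: "norm (append_col E' f') * sqrt (1 + (norm z)\<^sup>2) = norm (b - A *v z)"
        using tls_correction[of A z b] by metis
      have "s \<le> (norm (append_col E' f'))\<^sup>2"
        using \<open>s \<le> _\<close> min[OF Ef'] by (meson norm_ge_zero order_trans power_mono)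
      then have "s * (1 + (norm z)\<^sup>2) \<le> (norm (append_col E' f') * sqrt (1 + (norm z)\<^sup>2))\<^sup>2"
        by (simp add: power_mult_distrib mult_right_mono)
      then show ?thesis
        by (simp only: eq)
    qed
    moreover have "(norm (b - A *v y))\<^sup>2 = s * (1 + (norm y)\<^sup>2)"
      using one_plus_norm_sq_pos[of y] by (simp add: s_def)
    ultimately show "\<exists>s. is_tls A b s y"
      by (auto simp: is_tls_def)
  next
    assume "\<exists>s. is_tls A b s y"
    then obtain s where s: "is_tls A b s y"
      by blast
    obtain E f where Ef: "(A + E) *v y = b + f"
      and eq: "norm (append_col E f) * sqrt (1 + (norm y)\<^sup>2) = norm (b - A *v y)"
      using tls_correction[of A y b] by metis
    have "(norm (append_col E f))\<^sup>2 * (1 + (norm y)\<^sup>2) = s * (1 + (norm y)\<^sup>2)"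
      using arg_cong[OF eq, of "\<lambda>t. t\<^sup>2"] is_tls_eq[OF s] by (simp add: power_mult_distrib)
    then have Es: "(norm (append_col E f))\<^sup>2 = s"
      using one_plus_norm_sq_pos[of y] by simp
    have "norm (append_col E f) \<le> norm (append_col E' f')"
      if "b + f' \<in> range ((*v) (A + E'))" for E' f'
    proof -
      obtain z where "b + f' = (A + E') *v z"
        using \<open>b + f' \<in> _\<close> by (rule rangeE)
      then have "s * (1 + (norm z)\<^sup>2) \<le> (norm (append_col E' f'))\<^sup>2 * (1 + (norm z)\<^sup>2)"
        using lower[of E' z f'] is_tls_le[OF s, of z] by simp
      then have "s \<le> (norm (append_col E' f'))\<^sup>2"
        using one_plus_norm_sq_pos[of z] by simp
      then show ?thesis
        using Es by (metis norm_ge_zero power2_le_imp_le)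
    qed
    then have "tls_minimizer A b E f"
      using Ef unfolding tls_minimizer_def tls_feasible_def frob_norm_eq_norm by (metis rangeI)
    then show "tls_solution A b y"
      using Ef by (auto simp: tls_solution_def)
  }
qed

section \<open>Stationarity, uniqueness and existence of minimizers\<close>

lemma norm_add_scaleR_square:
  "(norm (a + t *\<^sub>R b))\<^sup>2 = (norm a)\<^sup>2 + 2 * t * (b \<bullet> a) + t\<^sup>2 * (norm b)\<^sup>2"
  for a :: "'a::real_inner"
  unfolding power2_norm_eq_inner
  by (simp add: inner_add_left inner_add_right inner_commute[of a b] power2_eq_square
      algebra_simps)

text \<open>Stationarity of the minimizer, in a form that needs no derivative: for \<open>z = y\<close>
  it is the definition of \<open>s\<close>, and varying \<open>z\<close> gives \<open>A\<^sup>T (b - A y) = - s y\<close>.\<close>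

lemma is_tls_inner:
  fixes A :: "real^'n^'m"
  assumes "is_tls A b s y"
  shows "(b - A *v z) \<bullet> (b - A *v y) = s * (1 + z \<bullet> y)"
proof -
  define r where "r = b - A *v y"
  define d where "d = z - y"
  have "- ((A *v d) \<bullet> r + s * (d \<bullet> y)) = 0"
  proof (rule linear_coeff_zero_if_nonneg)
    fix t
    have res: "b - A *v (y + t *\<^sub>R d) = r - t *\<^sub>R (A *v d)"
      by (simp add: r_def matrix_vector_right_distrib matrix_vector_mult_scaleR)
    have "0 \<le> (norm (b - A *v (y + t *\<^sub>R d)))\<^sup>2 - s * (1 + (norm (y + t *\<^sub>R d))\<^sup>2)
        - ((norm r)\<^sup>2 - s * (1 + (norm y)\<^sup>2))"
      using is_tls_le[OF assms, of "y + t *\<^sub>R d"] is_tls_eq[OF assms] by (simp add: r_def)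
    also have "\<dots> = 2 * t * - ((A *v d) \<bullet> r + s * (d \<bullet> y))
        + t\<^sup>2 * ((norm (A *v d))\<^sup>2 - s * (norm d)\<^sup>2)"
      using norm_add_scaleR_square[of r "- t" "A *v d"] norm_add_scaleR_square[of y t d]
      unfolding res by (simp add: algebra_simps)
    finally show "0 \<le> \<dots>" .
  qed
  moreover have "(b - A *v z) \<bullet> r = (norm r)\<^sup>2 - (A *v d) \<bullet> r"
    by (simp add: r_def d_def power2_norm_eq_inner inner_simps matrix_vector_mult_diff_distrib)
  moreover have "(norm r)\<^sup>2 = s * (1 + (norm y)\<^sup>2)"
    using is_tls_eq[OF assms] by (simp add: r_def)
  ultimately show ?thesis
    by (simp add: r_def d_def power2_norm_eq_inner inner_simps algebra_simps)
qed

lemma is_tls_gradient: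
  fixes A :: "real^'n^'m"
  assumes "is_tls A b s y"
  shows "transpose A *v (b - A *v y) = - s *\<^sub>R y"
proof -
  have "(transpose A *v (b - A *v y) + s *\<^sub>R y) \<bullet> z = 0" for z
  proof -
    have "(transpose A *v (b - A *v y)) \<bullet> z = (b - A *v 0) \<bullet> (b - A *v y) - (b - A *v z) \<bullet> (b - A *v y)"
      unfolding inner_transpose_mult by (simp add: inner_simps inner_commute)
    also have "\<dots> = - s * (y \<bullet> z)"
      unfolding is_tls_inner[OF assms] by (simp add: inner_commute algebra_simps)
    finally show ?thesis
      by (simp add: inner_simps)
  qed
  then have "transpose A *v (b - A *v y) + s *\<^sub>R y = 0"
    using inner_eq_zero_iff by blast
  then show ?thesis
    by (simp add: eq_neg_iff_add_eq_0)
qed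

lemma is_tls_value_unique:
  assumes "is_tls A b s y" "is_tls A b t z"
  shows "s = t"
  using is_tls_le[OF assms(1), of z] is_tls_le[OF assms(2), of y] is_tls_eq[OF assms(1)]
    is_tls_eq[OF assms(2)] one_plus_norm_sq_pos[of y] one_plus_norm_sq_pos[of z] by simp

text \<open>Subtracting the two gradient equations makes \<open>y - z\<close> an eigenvector of
  \<open>transpose A ** A\<close> for \<open>s\<close>, which the gap excludes.\<close>

lemma is_tls_unique:
  fixes A :: "real^'n^'m"
  assumes "is_tls A b s y" "is_tls A b t z"
    and gap: "\<And>u. u \<noteq> 0 \<Longrightarrow> s * (norm u)\<^sup>2 < (norm (A *v u))\<^sup>2"
  shows "y = z"
proof (rule ccontr)
  assume "y \<noteq> z"
  have "t = s"
    using is_tls_value_unique assms(1,2) by blast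
  have "transpose A *v (A *v (y - z)) = transpose A *v (b - A *v z) - transpose A *v (b - A *v y)"
    by (simp add: matrix_vector_mult_diff_distrib del: transpose_matrix_vector)
  also have "\<dots> = s *\<^sub>R (y - z)"
    unfolding is_tls_gradient[OF assms(1)] is_tls_gradient[OF assms(2)] \<open>t = s\<close>
    by (simp add: scaleR_diff_right)
  finally have "(norm (A *v (y - z)))\<^sup>2 = s * (norm (y - z))\<^sup>2"
    by (metis inner_scaleR_left inner_transpose_mult power2_norm_eq_inner)
  then show False
    using gap[of "y - z"] \<open>y \<noteq> z\<close> by simp
qed

text \<open>Minimizing over the unit sphere of the homogenized variables avoids any discussion of the
  behaviour at infinity: the gap condition excludes minimizers there.\<close>

lemma is_tls_exists:
  fixes A :: "real^'n^'m"
  assumes gap: "\<And>u. \<mu> * (norm u)\<^sup>2 \<le> (norm (A *v u))\<^sup>2"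
    and z: "(norm (b - A *v z))\<^sup>2 < \<mu> * (1 + (norm z)\<^sup>2)"
  obtains s y where "is_tls A b s y" "s < \<mu>"
proof -
  \<comment> \<open>A point \<open>(u, t)\<close> with \<open>t \<noteq> 0\<close> represents the
    vector \<open>u /\<^sub>R t\<close>; points with \<open>t = 0\<close> lie at infinity.\<close>
  define g where "g p = (norm (snd p *\<^sub>R b - A *v fst p))\<^sup>2" for p :: "(real^'n) \<times> real"
  have "continuous_on (sphere 0 1) g"
    unfolding g_def
    by (intro continuous_intros bounded_linear.continuous_on[OF matrix_vector_mul_bounded_linear])
  moreover have "sphere 0 1 \<noteq> ({} :: ((real^'n) \<times> real) set)"
    by simp
  ultimately obtain p where p: "p \<in> sphere 0 1" and min: "\<And>q. q \<in> sphere 0 1 \<Longrightarrow> g p \<le> g q"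
    using continuous_attains_inf[OF compact_sphere, of 0 1 g] by blast
  obtain u t where ut: "p = (u, t)"
    by (cases p)
  have norm_p: "(norm u)\<^sup>2 + t\<^sup>2 = 1"
    using p ut by (simp add: norm_Pair)
  define s where "s = g p"
  have hom: "s * (1 + (norm v)\<^sup>2) \<le> (norm (b - A *v v))\<^sup>2" for v
  proof -
    define c where "c = sqrt (1 + (norm v)\<^sup>2)"
    have c: "c > 0" "c\<^sup>2 = 1 + (norm v)\<^sup>2"
      using one_plus_norm_sq_pos[of v] by (simp_all add: c_def)
    have "(norm (v /\<^sub>R c, 1 / c))\<^sup>2 = ((norm v)\<^sup>2 + 1) / c\<^sup>2"
      using c(1) by (simp add: norm_Pair power_mult_distrib power_divide field_simps)
    then have "(norm (v /\<^sub>R c, 1 / c))\<^sup>2 = 1\<^sup>2"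
      using c one_plus_norm_sq_pos[of v] by (simp add: add.commute)
    then have "(v /\<^sub>R c, 1 / c) \<in> sphere 0 1"
      using power2_eq_imp_eq[OF _ norm_ge_zero zero_le_one] by simp
    then have "s \<le> g (v /\<^sub>R c, 1 / c)"
      using min by (simp add: s_def)
    also have "g (v /\<^sub>R c, 1 / c) = (norm ((1 / c) *\<^sub>R (b - A *v v)))\<^sup>2"
      by (simp add: g_def matrix_vector_mult_scaleR scaleR_diff_right divide_inverse)
    also have "\<dots> = (norm (b - A *v v))\<^sup>2 / c\<^sup>2"
      by (simp add: power_divide)
    finally show ?thesis
      using c one_plus_norm_sq_pos[of v] by (simp add: le_divide_eq mult_ac)
  qed
  have s_less: "s < \<mu>"
    using order_le_less_trans[OF hom z] one_plus_norm_sq_pos[of z] by simp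
  have "t \<noteq> 0"
  proof
    assume "t = 0"
    then have "s = (norm (A *v u))\<^sup>2" "(norm u)\<^sup>2 = 1"
      using norm_p by (simp_all add: s_def g_def ut)
    then show False
      using gap[of u] s_less by simp
  qed
  have "(norm (b - A *v (u /\<^sub>R t)))\<^sup>2 = (norm ((1 / t) *\<^sub>R (t *\<^sub>R b - A *v u)))\<^sup>2"
    using \<open>t \<noteq> 0\<close> by (simp add: matrix_vector_mult_scaleR scaleR_diff_right divide_inverse)
  also have "\<dots> = s / t\<^sup>2"
    by (simp add: s_def g_def ut power_divide)
  also have "\<dots> = s * (((norm u)\<^sup>2 + t\<^sup>2) / t\<^sup>2)"
    by (simp add: norm_p)
  also have "\<dots> = s * (1 + (norm (u /\<^sub>R t))\<^sup>2)"
    using \<open>t \<noteq> 0\<close> by (simp add: power_mult_distrib power_inverse field_simps)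
  finally have "is_tls A b s (u /\<^sub>R t)"
    using hom by (simp add: is_tls_def)
  then show thesis
    using that s_less by blast
qed

text \<open>This translates the hypotheses on singular values into a value of the minimum and a
  lower bound for \<open>A\<close>; afterwards \<open>singular_value\<close> is no longer needed.
  The witness for \<open>\<mu>\<close> is the smallest singular value of \<open>A\<close>.\<close>

lemma genericity_gap:
  fixes A :: "real^'n^'m"
  assumes nm: "CARD('n) \<le> CARD('m)"
    and sig: "\<sigma> = singular_value (append_col A b) (CARD('n) + 1)"
    and gen: "\<sigma> < singular_value A CARD('n)"
    and tls: "is_tls A b s x"
  obtains \<mu> where "s = \<sigma>\<^sup>2" "0 \<le> \<sigma>" "\<sigma> < \<mu>" "\<And>u. \<mu>\<^sup>2 * (norm u)\<^sup>2 \<le> (norm (A *v u))\<^sup>2"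
proof -
  obtain l where l: "singular_value A CARD('n) = sqrt l"
    and gap: "\<And>w. l * (norm w)\<^sup>2 \<le> (norm (A *v w))\<^sup>2"
    using smallest_singular_value[OF nm] by metis
  have "s = \<sigma>\<^sup>2 \<and> 0 \<le> \<sigma>"
  proof (cases "CARD('n) = CARD('m)")
    \<comment> \<open>Here \<open>CARD('n) + 1\<close> exceeds the number of singular values, so
      \<open>\<sigma> = 0\<close> by convention. Correspondingly \<open>A\<close> is bijective, the
      system is solvable exactly and \<open>s = 0\<close>.\<close>
    case True
    then have "\<sigma> = 0"
      using sig by (simp add: singular_value_def)
    then have "l > 0"
      using gen l by simp
    have "inj ((*v) A)"
    proof (rule injI)
      fix v w assume "A *v v = A *v w"
      then have "l * (norm (v - w))\<^sup>2 \<le> 0"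
        using gap[of "v - w"] by (simp add: matrix_vector_mult_diff_distrib)
      then show "v = w"
        using \<open>l > 0\<close> by (simp add: mult_le_0_iff)
    qed
    then have "dim (range ((*v) A)) = DIM(real^'m)"
      using True by (simp add: dim_image_eq[OF matrix_vector_mul_linear])
    then have "range ((*v) A) = UNIV"
      by (metis dim_eq_full matrix_vector_mul_linear span_eq_iff subspace_UNIV linear_subspace_image)
    then obtain z where "b = A *v z"
      by (metis UNIV_I imageE)
    then have "s \<le> 0"
      using is_tls_le[OF tls, of z] one_plus_norm_sq_pos[of z] by (simp add: mult_le_0_iff)
    then show ?thesis
      using is_tls_nonneg[OF tls] \<open>\<sigma> = 0\<close> by simp
  next
    case False
    then have "CARD('n option) \<le> CARD('m)"
      using nm by simp
    then obtain k z where k: "singular_value (append_col A b) CARD('n option) = sqrt k" and "z \<noteq> 0"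
      and kz: "(norm (append_col A b *v z))\<^sup>2 = k * (norm z)\<^sup>2"
      and kmin: "\<And>w. k * (norm w)\<^sup>2 \<le> (norm (append_col A b *v w))\<^sup>2"
      using smallest_singular_value by metis
    have sigk: "\<sigma> = sqrt k"
      using k sig by simp
    have "0 \<le> k * (norm z)\<^sup>2"
      by (metis kz zero_le_power2)
    then have "0 \<le> k"
      using \<open>z \<noteq> 0\<close> by (simp add: zero_le_mult_iff)
    have "k < l"
      using gen l sigk by simp
    have "s = k"
    proof (rule antisym)
      \<comment> \<open>The minimal right singular vector \<open>z\<close> of the augmented matrix
        has \<open>t \<noteq> 0\<close> by the gap, so dividing by \<open>- t\<close> turns it into
        a trial vector showing \<open>s \<le> k\<close>. Conversely, the entries \<open>- x\<close>
        and 1 form a trial vector \<open>w\<close> for \<open>k \<le> s\<close>.\<close>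
      define u where "u = (\<chi> j. z $ Some j)"
      define t where "t = z $ None"
      have eq: "(norm (A *v u + t *\<^sub>R b))\<^sup>2 = k * (t\<^sup>2 + (norm u)\<^sup>2)"
        using kz by (simp only: append_col_mult norm_option_vec u_def t_def)
      have "t \<noteq> 0"
      proof
        assume "t = 0"
        then have "l * (norm u)\<^sup>2 \<le> k * (norm u)\<^sup>2"
          using eq gap[of u] by simp
        then have "norm u = 0"
          using \<open>k < l\<close> by (smt (verit) mult_right_le_imp_le zero_less_power2)
        then show False
          using \<open>z \<noteq> 0\<close> \<open>t = 0\<close> norm_option_vec[of z] by (simp add: u_def t_def)
      qed
      have "(norm (b - A *v ((- 1 / t) *\<^sub>R u)))\<^sup>2 = (norm ((1 / t) *\<^sub>R (A *v u + t *\<^sub>R b)))\<^sup>2"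
        using \<open>t \<noteq> 0\<close> unfolding matrix_vector_mult_scaleR by (simp add: scaleR_add_right add.commute)
      also have "\<dots> = k * (t\<^sup>2 + (norm u)\<^sup>2) / t\<^sup>2"
        by (simp add: power_divide eq)
      also have "\<dots> = k * (1 + (norm ((- 1 / t) *\<^sub>R u))\<^sup>2)"
        using \<open>t \<noteq> 0\<close> by (simp add: power_divide field_simps)
      finally show "s \<le> k"
        using is_tls_le[OF tls, of "(- 1 / t) *\<^sub>R u"] one_plus_norm_sq_pos by (metis mult_right_le_imp_le)
      define w :: "real^('n option)" where "w = (\<chi> j. case j of None \<Rightarrow> 1 | Some i \<Rightarrow> - x $ i)"
      have w: "w $ None = 1" "(\<chi> i. w $ Some i) = - x"
        by (simp_all add: w_def vec_eq_iff)
      have "append_col A b *v w = b - A *v x"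
        unfolding append_col_mult w by (simp add: vec_eq_iff matrix_vector_mult_def sum_negf)
      moreover have "(norm w)\<^sup>2 = 1 + (norm x)\<^sup>2"
        by (simp add: norm_option_vec w)
      ultimately have "k * (1 + (norm x)\<^sup>2) \<le> s * (1 + (norm x)\<^sup>2)"
        using kmin[of w] is_tls_eq[OF tls] by simp
      then show "k \<le> s"
        using one_plus_norm_sq_pos[of x] by simp
    qed
    then show ?thesis
      using sigk \<open>0 \<le> k\<close> by simp
  qed
  moreover have "0 \<le> l"
    using gen l calculation by (metis less_le_not_le order_trans real_sqrt_ge_0_iff)
  ultimately show thesis
    using that[of "sqrt l"] gen l gap by simp
qed

section \<open>Perturbation\<close>

lemma transpose_add: "transpose (A + B) = transpose A + transpose B"
  by (simp add: vec_eq_iff transpose_def)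

lemma append_col_uminus: "append_col (- E) (- f) = - append_col E f"
  by (auto simp: vec_eq_iff append_col_def split: option.split)

lemma norm_le_append_col:
  fixes E :: "real^'n^'m"
  shows "norm E \<le> norm (append_col E f)" "norm f \<le> norm (append_col E f)"
  using norm_append_col[of E f] by (simp_all add: power2_le_imp_le)

lemma is_tls_norm_residual:
  fixes A :: "real^'n^'m"
  assumes "is_tls A b s y"
  shows "norm (b - A *v y) = sqrt s * sqrt (1 + (norm y)\<^sup>2)"
  using is_tls_eq[OF assms] by (metis norm_ge_zero real_sqrt_mult real_sqrt_unique)

lemma perturbed_residual_le:
  fixes A E :: "real^'n^'m"
  shows "norm (b + f - (A + E) *v y) \<le> norm (b - A *v y) + norm (append_col E f) * sqrt (1 + (norm y)\<^sup>2)"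
proof -
  have eq: "b + f - (A + E) *v y = (b - A *v y) + (f - E *v y)"
    by (simp add: matrix_vector_mult_add_rdistrib)
  show ?thesis
    unfolding eq
    using norm_triangle_ineq[of "b - A *v y" "f - E *v y"] norm_residual_le[of f E y] by linarith
qed

text \<open>The old minimizer \<open>x\<close> is a trial vector for the perturbed quotient.\<close>

lemma is_tls_value_perturbed_le:
  fixes A E :: "real^'n^'m"
  assumes "is_tls A b s x" "is_tls (A + E) (b + f) t y"
  shows "sqrt t \<le> sqrt s + norm (append_col E f)"
proof -
  let ?c = "sqrt (1 + (norm x)\<^sup>2)"
  have c: "0 < ?c"
    using one_plus_norm_sq_pos[of x] by simp
  have "sqrt t * ?c \<le> norm (b + f - (A + E) *v x)"
    using is_tls_le[OF assms(2), of x] by (metis norm_ge_zero real_le_lsqrt real_sqrt_mult)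
  also have "\<dots> \<le> (sqrt s + norm (append_col E f)) * ?c"
    using perturbed_residual_le[of b f A E x] is_tls_norm_residual[OF assms(1)]
    by (simp add: distrib_right)
  finally show ?thesis
    using c by simp
qed

text \<open>The second inequality comes from regarding the original problem as the perturbation of
  the new one by \<open>- E\<close> and \<open>- f\<close>.\<close>

lemma is_tls_value_perturbed:
  fixes A E :: "real^'n^'m"
  assumes "is_tls A b s x" "is_tls (A + E) (b + f) t y"
  shows "\<bar>sqrt t - sqrt s\<bar> \<le> norm (append_col E f)"
proof -
  have "is_tls ((A + E) + (- E)) ((b + f) + (- f)) s x"
    using assms(1) by simp
  from is_tls_value_perturbed_le[OF assms(2) this] is_tls_value_perturbed_le[OF assms]
  show ?thesis
    by (simp add: append_col_uminus)
qed

text \<open>The perturbation lowers the bound \<open>\<mu>\<close> for \<open>A\<close> by at most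
  \<open>\<eta>\<close> and raises the root of the quotient at \<open>x\<close> by at most
  \<open>\<eta>\<close>. The smallness condition says exactly that
  \<open>\<sigma> + \<eta> < \<nu>\<close>, so the gap persists.\<close>

lemma perturbed_solution_ex1:
  fixes A E :: "real^'n^'m"
  assumes tls: "is_tls A b (\<sigma>\<^sup>2) x" and "0 \<le> \<sigma>"
    and gap: "\<And>u. \<mu>\<^sup>2 * (norm u)\<^sup>2 \<le> (norm (A *v u))\<^sup>2"
    and small: "norm (append_col E f) < (\<mu> - \<sigma>) / 2"
  shows "\<exists>!y. tls_solution (A + E) (b + f) y"
proof -
  define \<eta> where "\<eta> = norm (append_col E f)"
  define \<nu> where "\<nu> = \<mu> - \<eta>"
  have "0 \<le> \<eta>"
    by (simp add: \<eta>_def)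
  have "\<sigma> + \<eta> < \<nu>"
    using small by (simp add: \<eta>_def \<nu>_def field_simps)
  have gap': "\<nu>\<^sup>2 * (norm u)\<^sup>2 \<le> (norm ((A + E) *v u))\<^sup>2" for u
  proof -
    have "\<mu> * norm u \<le> norm (A *v u)"
      using gap[of u] by (auto intro: power2_le_imp_le simp: power_mult_distrib)
    moreover have "norm (E *v u) \<le> \<eta> * norm u"
      using norm_matrix_vector_mult_le[of E u] norm_le_append_col(1)[of E f]
      unfolding \<eta>_def by (meson mult_right_mono norm_ge_zero order_trans)
    moreover have "norm (A *v u) \<le> norm ((A + E) *v u) + norm (E *v u)"
      using norm_triangle_ineq4[of "(A + E) *v u" "E *v u"]
      by (simp add: matrix_vector_mult_add_rdistrib)
    ultimately have "\<nu> * norm u \<le> norm ((A + E) *v u)"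
      by (simp add: \<nu>_def left_diff_distrib)
    then have "(\<nu> * norm u)\<^sup>2 \<le> (norm ((A + E) *v u))\<^sup>2"
      using \<open>\<sigma> + \<eta> < \<nu>\<close> \<open>0 \<le> \<sigma>\<close> \<open>0 \<le> \<eta>\<close> by (intro power_mono) auto
    then show ?thesis
      by (simp add: power_mult_distrib)
  qed
  have "norm (b + f - (A + E) *v x) \<le> (\<sigma> + \<eta>) * sqrt (1 + (norm x)\<^sup>2)"
    using perturbed_residual_le[of b f A E x] is_tls_norm_residual[OF tls] \<open>0 \<le> \<sigma>\<close>
    by (simp add: \<eta>_def distrib_right)
  also have "\<dots> < \<nu> * sqrt (1 + (norm x)\<^sup>2)"
    using \<open>\<sigma> + \<eta> < \<nu>\<close> one_plus_norm_sq_pos[of x] by simp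
  finally have "(norm (b + f - (A + E) *v x))\<^sup>2 < (\<nu> * sqrt (1 + (norm x)\<^sup>2))\<^sup>2"
    by (intro power_strict_mono) auto
  then have "(norm (b + f - (A + E) *v x))\<^sup>2 < \<nu>\<^sup>2 * (1 + (norm x)\<^sup>2)"
    by (simp add: power_mult_distrib)
  then obtain s y where y: "is_tls (A + E) (b + f) s y" and "s < \<nu>\<^sup>2"
    using is_tls_exists[OF gap'] by metis
  have "s * (norm u)\<^sup>2 < (norm ((A + E) *v u))\<^sup>2" if "u \<noteq> 0" for u
  proof -
    have "s * (norm u)\<^sup>2 < \<nu>\<^sup>2 * (norm u)\<^sup>2"
      using that \<open>s < \<nu>\<^sup>2\<close> by simp
    then show ?thesis
      using gap'[of u] by simp
  qed
  then have "z = y" if "is_tls (A + E) (b + f) t z" for t z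
    using is_tls_unique[OF y that] by simp
  then show ?thesis
    unfolding tls_solution_iff using y by blast
qed

text \<open>With \<open>r\<close> the residual at \<open>x\<close> the left-hand side is \<open>A\<^sup>T H e\<close>, where \<open>H\<close> is the
  Householder reflection along \<open>r\<close>: since \<open>A\<^sup>T r = - s x\<close> and \<open>\<parallel>r\<parallel>\<^sup>2 = s (1 + \<parallel>x\<parallel>\<^sup>2)\<close>, the term
  contributed by the variation of \<open>s\<close> is a multiple of \<open>A\<^sup>T r\<close>. So this term costs nothing.\<close>

lemma householder_absorbs:
  fixes A :: "real^'n^'m"
  assumes tls: "is_tls A b s x" and r: "r = b - A *v x"
  obtains e' where "norm e' = norm e"
    "transpose A *v e + (2 * (e \<bullet> r) / (1 + (norm x)\<^sup>2)) *\<^sub>R x = transpose A *v e'"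
proof (cases "r = 0")
  case True
  then show thesis
    using that[of e] by simp
next
  case False
  define c where "c = 1 + (norm x)\<^sup>2"
  define k where "k = 2 * (e \<bullet> r) / (r \<bullet> r)"
  have rr: "r \<bullet> r = s * c"
    using is_tls_eq[OF tls] by (simp add: r c_def power2_norm_eq_inner)
  then have "s \<noteq> 0" "c \<noteq> 0"
    using False by auto
  have "(norm (e - k *\<^sub>R r))\<^sup>2 = (norm e)\<^sup>2 - 2 * k * (r \<bullet> e) + k\<^sup>2 * (r \<bullet> r)"
    using norm_add_scaleR_square[of e "- k" r] by (simp add: power2_norm_eq_inner)
  also have "k\<^sup>2 * (r \<bullet> r) = 2 * k * (r \<bullet> e)"
    using False by (simp add: k_def power2_eq_square inner_commute[of r e])
  finally have "norm (e - k *\<^sub>R r) = norm e"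
    by (simp add: power2_eq_iff_nonneg)
  moreover have "transpose A *v (e - k *\<^sub>R r) = transpose A *v e + (k * s) *\<^sub>R x"
    using is_tls_gradient[OF tls]
    by (simp add: matrix_vector_mult_diff_distrib matrix_vector_mult_scaleR r[symmetric]
        del: transpose_matrix_vector)
  moreover have "k * s = 2 * (e \<bullet> r) / c"
    using \<open>s \<noteq> 0\<close> by (simp add: k_def rr)
  ultimately show thesis
    using that[of "e - k *\<^sub>R r"] by (simp add: c_def)
qed

text \<open>The powers of \<open>K\<close> are not optimized; only their independence of \<open>E\<close> and \<open>f\<close> matters.\<close>

lemma tls_perturbation_bound:
  fixes A E :: "real^'n^'m" and b f r :: "real^'m" and x d :: "real^'n" and P :: "real^'n^'n"
  assumes tls: "is_tls A b s x" and tls': "is_tls (A + E) (b + f) t (x + d)"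
    and r: "r = b - A *v x"
    and P: "P ** (transpose A ** A - s *\<^sub>R mat 1) = mat 1"
    and K: "1 \<le> K" "norm A \<le> K" "norm P \<le> K" "norm x \<le> K" "norm r \<le> K" "sqrt s \<le> K"
    and \<eta>: "\<eta> = norm (append_col E f)" "\<eta> \<le> 1 / (12 * K\<^sup>2)"
  shows "norm d \<le> spectral_norm (P ** transpose A) * (norm f + spectral_norm E * norm x)
    + spectral_norm P * (spectral_norm E * norm r) + 320 * K ^ 7 * \<eta>\<^sup>2"
proof -
  note [simp del] = transpose_matrix_vector
  define e where "e = f - E *v x"
  define r' where "r' = b + f - (A + E) *v (x + d)"
  \<comment> \<open>These are the second-order terms in the equation for \<open>t - s\<close>: every
    summand is a product of two small quantities.\<close>
  define m where "m = e \<bullet> (e - A *v d - E *v d) - r \<bullet> (E *v d) - (t - s) * (x \<bullet> d)"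
  have res: "r' = r + e - A *v d - E *v d"
    by (simp add: r'_def r e_def matrix_vector_mult_add_rdistrib matrix_vector_right_distrib)

  \<comment> \<open>Exact identities for \<open>d\<close> and \<open>t - s\<close>\<close>
  have Pv: "P *v (transpose A *v (A *v v) - s *\<^sub>R v) = v" for v
  proof -
    have "P *v ((transpose A ** A - s *\<^sub>R mat 1) *v v) = v"
      by (simp add: matrix_vector_mul_assoc P)
    then show ?thesis
      by (simp add: matrix_vector_mult_diff_rdistrib scaleR_matrix_vector_assoc[symmetric]
          matrix_vector_mul_assoc)
  qed
  have 1: "transpose A *v r' = transpose A *v r + transpose A *v e - transpose A *v (A *v d)
      - transpose A *v (E *v d)"
    unfolding res by (simp add: matrix_vector_mult_diff_distrib matrix_vector_right_distrib)
  have 2: "transpose E *v r' = - t *\<^sub>R (x + d) - transpose A *v r'"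
    using is_tls_gradient[OF tls']
    by (simp add: r'_def transpose_add matrix_vector_mult_add_rdistrib eq_diff_eq add.commute)
  have 3: "transpose A *v r = - s *\<^sub>R x"
    using is_tls_gradient[OF tls] by (simp add: r)
  have "transpose A *v (A *v d) - s *\<^sub>R d = transpose A *v e - transpose A *v (E *v d)
      + transpose E *v r' + (t - s) *\<^sub>R (x + d)"
    unfolding 2 1 3 by (simp add: algebra_simps)
  then have d1: "d = P *v (transpose A *v e - transpose A *v (E *v d)
      + transpose E *v r' + (t - s) *\<^sub>R (x + d))"
    using Pv[of d] by simp
  \<comment> \<open>Evaluating each identity at the other problem's minimizer gives both right-hand
    sides the same factor \<open>1 + x \<bullet> (x + d)\<close> and cancels the first-order term
    \<open>r \<bullet> (A *v d)\<close>.\<close>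
  have ts: "(t - s) * (1 + (norm x)\<^sup>2) = 2 * (e \<bullet> r) + m"
  proof -
    have eq: "b + f - (A + E) *v x = r + e" "b - A *v (x + d) = r - A *v d"
      by (simp_all add: r e_def matrix_vector_mult_add_rdistrib matrix_vector_right_distrib)
    have "(r + e) \<bullet> r' = t * (1 + x \<bullet> (x + d))" "(r - A *v d) \<bullet> r = s * (1 + (x + d) \<bullet> x)"
      using is_tls_inner[OF tls', of x] is_tls_inner[OF tls, of "x + d"]
      unfolding eq r[symmetric] r'_def[symmetric] by simp_all
    then show ?thesis
      unfolding res m_def power2_norm_eq_inner
      by (simp add: inner_add_left inner_add_right inner_diff_left inner_diff_right
          inner_commute[of r e] inner_commute[of "A *v d" r] inner_commute[of d x] algebra_simps)
  qed
  obtain e' where e': "norm e' = norm e"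
    and He: "transpose A *v e + (2 * (e \<bullet> r) / (1 + (norm x)\<^sup>2)) *\<^sub>R x = transpose A *v e'"
    using householder_absorbs[OF tls r] by metis
  \<comment> \<open>Once the first-order part of \<open>(t - s) *\<^sub>R x\<close> is absorbed into
    \<open>e'\<close>, this is the whole second-order remainder.\<close>
  define w where "w = (m / (1 + (norm x)\<^sup>2)) *\<^sub>R x - transpose A *v (E *v d)
    + transpose E *v (r' - r) + (t - s) *\<^sub>R d"
  have "t - s = 2 * (e \<bullet> r) / (1 + (norm x)\<^sup>2) + m / (1 + (norm x)\<^sup>2)"
    using ts one_plus_norm_sq_pos[of x] by (simp add: eq_divide_eq flip: add_divide_distrib)
  then have tsx: "(t - s) *\<^sub>R x = (2 * (e \<bullet> r) / (1 + (norm x)\<^sup>2)) *\<^sub>R x + (m / (1 + (norm x)\<^sup>2)) *\<^sub>R x"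
    by (metis scaleR_add_left)
  have "transpose A *v e - transpose A *v (E *v d) + transpose E *v r' + (t - s) *\<^sub>R (x + d)
      = transpose A *v e' + transpose E *v r + w"
    unfolding w_def He[symmetric] scaleR_add_right tsx matrix_vector_mult_diff_distrib by simp
  then have d2: "d = (P ** transpose A) *v e' + P *v (transpose E *v r) + P *v w"
    using d1 by (simp add: matrix_vector_right_distrib matrix_vector_mul_assoc)

  \<comment> \<open>Crude bounds in terms of \<open>K\<close>, \<open>\<eta>\<close> and
    \<open>D\<close>\<close>
  have "0 \<le> \<eta>" "norm E \<le> \<eta>" "norm f \<le> \<eta>"
    using norm_le_append_col(1)[of E f] norm_le_append_col(2)[of f E] by (simp_all add: \<eta>(1))
  have K2: "1 \<le> K\<^sup>2"
    using K(1) by (rule one_le_power)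
  have K2\<eta>: "12 * K\<^sup>2 * \<eta> \<le> 1"
  proof -
    have "12 * K\<^sup>2 * \<eta> \<le> 12 * K\<^sup>2 * (1 / (12 * K\<^sup>2))"
      by (intro mult_left_mono \<eta>(2)) simp
    also have "\<dots> = 1"
      using K(1) by simp
    finally show ?thesis .
  qed
  have "\<eta> \<le> 1"
    using K2\<eta> mult_right_mono[OF K2 \<open>0 \<le> \<eta>\<close>] \<open>0 \<le> \<eta>\<close> by linarith
  have nA: "norm (A *v v) \<le> K * norm v" for v
    using norm_matrix_vector_mult_le[of A v] mult_right_mono[OF K(2) norm_ge_zero[of v]] by linarith
  have nE: "norm (E *v v) \<le> \<eta> * norm v" for v
    using norm_matrix_vector_mult_le[of E v] mult_right_mono[OF \<open>norm E \<le> \<eta>\<close> norm_ge_zero[of v]] by linarith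
  have nP: "norm (P *v v) \<le> K * norm v" for v
    using norm_matrix_vector_mult_le[of P v] mult_right_mono[OF K(3) norm_ge_zero[of v]] by linarith
  note nAt = norm_transpose_mult_le[OF nA] and nEt = norm_transpose_mult_le[OF nE]
  define D where "D = norm d"
  have "0 \<le> D" "0 \<le> K"
    using K(1) by (simp_all add: D_def)
  have ne: "norm e \<le> 2 * K * \<eta>"
  proof -
    have "norm e \<le> \<eta> + \<eta> * norm x"
      unfolding e_def using norm_triangle_ineq4[of f "E *v x"] nE[of x] \<open>norm f \<le> \<eta>\<close> by linarith
    also have "\<dots> \<le> \<eta> * K + \<eta> * K"
      using K(1,4) \<open>0 \<le> \<eta>\<close> mult_left_mono[of 1 K \<eta>] by (intro add_mono mult_left_mono) auto
    finally show ?thesis by simp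
  qed
  have nts: "\<bar>t - s\<bar> \<le> 3 * K * \<eta>"
  proof -
    have "0 \<le> s" "0 \<le> t"
      using is_tls_nonneg[OF tls] is_tls_nonneg[OF tls'] by auto
    then have "t - s = (sqrt t - sqrt s) * (sqrt t + sqrt s)"
      by (simp add: algebra_simps)
    then have "\<bar>t - s\<bar> = \<bar>sqrt t - sqrt s\<bar> * (sqrt t + sqrt s)"
      using \<open>0 \<le> s\<close> \<open>0 \<le> t\<close> by (simp add: abs_mult)
    also have "\<dots> \<le> \<eta> * (3 * K)"
      using is_tls_value_perturbed[OF tls tls'] K(1,6) \<open>\<eta> \<le> 1\<close> \<open>0 \<le> s\<close> \<open>0 \<le> t\<close>
      by (intro mult_mono) (auto simp: \<eta>(1))
    finally show ?thesis by (simp add: mult_ac)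
  qed
  have nd: "norm (e - A *v d - E *v d) \<le> 2 * K * \<eta> + 2 * K * D"
  proof -
    have "norm (e - A *v d - E *v d) \<le> norm e + norm (A *v d) + norm (E *v d)"
      using norm_triangle_ineq4[of "e - A *v d" "E *v d"] norm_triangle_ineq4[of e "A *v d"] by linarith
    moreover have "\<eta> * D \<le> K * D"
      using \<open>\<eta> \<le> 1\<close> K(1) \<open>0 \<le> D\<close> by (intro mult_right_mono) auto
    ultimately show ?thesis
      using ne nA[of d] nE[of d] by (simp add: D_def)
  qed
  have nr': "norm r' \<le> 3 * K + 2 * K * D"
  proof -
    have "norm r' \<le> norm r + norm (e - A *v d - E *v d)"
      unfolding res using norm_triangle_ineq[of r "e - A *v d - E *v d"] by (simp add: algebra_simps)
    moreover have "K * \<eta> \<le> K"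
      using \<open>\<eta> \<le> 1\<close> \<open>0 \<le> K\<close> by (simp add: mult_left_le)
    ultimately show ?thesis
      using nd K(5) by linarith
  qed
  have nAEd: "norm (transpose A *v (E *v d)) \<le> K * (\<eta> * D)"
    using nAt[of "E *v d"] mult_left_mono[OF nE[of d] \<open>0 \<le> K\<close>] by (simp add: D_def)

  \<comment> \<open>First-order size of \<open>d\<close> and second-order size of the
    remainder\<close>
  define L where "L = 16 * K ^ 3"
  have "1 \<le> L"
    using one_le_power[OF K(1), of 3] by (simp add: L_def)
  have DL: "D \<le> L * \<eta>"
  proof -
    define q where "q = transpose A *v e - transpose A *v (E *v d)
      + transpose E *v r' + (t - s) *\<^sub>R (x + d)"
    have "norm q \<le> norm (transpose A *v e) + norm (transpose A *v (E *v d)) + norm (transpose E *v r')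
          + norm ((t - s) *\<^sub>R (x + d))"
      unfolding q_def
      by (intro order_trans[OF norm_triangle_ineq] add_mono norm_triangle_ineq4 order_refl)
    also have "\<dots> \<le> K * (2 * K * \<eta>) + K * (\<eta> * D) + \<eta> * (3 * K + 2 * K * D) + 3 * K * \<eta> * (K + D)"
    proof (intro add_mono nAEd)
      show "norm (transpose A *v e) \<le> K * (2 * K * \<eta>)"
        using nAt[of e] mult_left_mono[OF ne \<open>0 \<le> K\<close>] by linarith
      show "norm (transpose E *v r') \<le> \<eta> * (3 * K + 2 * K * D)"
        using nEt[of r'] mult_left_mono[OF nr' \<open>0 \<le> \<eta>\<close>] by linarith
      have "norm (x + d) \<le> K + D"
        using norm_triangle_ineq[of x d] K(4) by (simp add: D_def)
      then show "norm ((t - s) *\<^sub>R (x + d)) \<le> 3 * K * \<eta> * (K + D)"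
        unfolding norm_scaleR using nts \<open>0 \<le> K\<close> \<open>0 \<le> \<eta>\<close> by (intro mult_mono) auto
    qed
    also have "\<dots> = 5 * K\<^sup>2 * \<eta> + 3 * K * \<eta> + 6 * K * \<eta> * D"
      by (simp add: power2_eq_square algebra_simps)
    finally have "K * norm q \<le> K * (5 * K\<^sup>2 * \<eta> + 3 * K * \<eta> + 6 * K * \<eta> * D)"
      using \<open>0 \<le> K\<close> by (rule mult_left_mono)
    moreover have "D = norm (P *v q)"
      unfolding D_def q_def using d1 by (rule arg_cong)
    ultimately have "D \<le> K * (5 * K\<^sup>2 * \<eta> + 3 * K * \<eta> + 6 * K * \<eta> * D)"
      using nP[of q] by linarith
    also have "\<dots> = 5 * K ^ 3 * \<eta> + 3 * K\<^sup>2 * \<eta> + (12 * K\<^sup>2 * \<eta>) * D / 2"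
      by (simp add: power2_eq_square power3_eq_cube algebra_simps)
    \<comment> \<open>The smallness of \<open>\<eta>\<close> was chosen so that the terms containing
      \<open>D\<close> are at most \<open>D / 2\<close>. Moving that half to the left doubles
      \<open>8 * K ^ 3\<close>, which gives \<open>L\<close>.\<close>
    also have "\<dots> \<le> 5 * K ^ 3 * \<eta> + 3 * K ^ 3 * \<eta> + D / 2"
    proof -
      have "3 * K\<^sup>2 * \<eta> \<le> 3 * K ^ 3 * \<eta>"
        using power_increasing[of 2 3 K] K(1) \<open>0 \<le> \<eta>\<close> by (intro mult_right_mono) auto
      moreover have "(12 * K\<^sup>2 * \<eta>) * D \<le> 1 * D"
        using K2\<eta> \<open>0 \<le> D\<close> by (rule mult_right_mono)
      ultimately show ?thesis
        by linarith
    qed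
    finally show ?thesis
      unfolding L_def by linarith
  qed
  have nr: "norm (e - A *v d - E *v d) \<le> 4 * K * L * \<eta>"
  proof -
    have "2 * K * \<eta> * 1 \<le> 2 * K * \<eta> * L" "2 * K * D \<le> 2 * K * (L * \<eta>)"
      using \<open>1 \<le> L\<close> DL \<open>0 \<le> K\<close> \<open>0 \<le> \<eta>\<close> by (intro mult_left_mono; simp)+
    then show ?thesis
      using nd by (simp add: mult_ac)
  qed
  have nm: "\<bar>m\<bar> \<le> 12 * K\<^sup>2 * L * \<eta>\<^sup>2"
  proof -
    have "\<bar>e \<bullet> (e - A *v d - E *v d)\<bar> \<le> (2 * K * \<eta>) * (4 * K * L * \<eta>)"
      using ne nr \<open>0 \<le> K\<close> \<open>0 \<le> \<eta>\<close>
      by (intro order_trans[OF Cauchy_Schwarz_ineq2] mult_mono) auto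
    moreover have "\<bar>r \<bullet> (E *v d)\<bar> \<le> K * (\<eta> * (L * \<eta>))"
      using K(5) nE[of d] mult_left_mono[OF DL \<open>0 \<le> \<eta>\<close>] \<open>0 \<le> K\<close> unfolding D_def
      by (intro order_trans[OF Cauchy_Schwarz_ineq2] mult_mono) auto
    moreover have "\<bar>(t - s) * (x \<bullet> d)\<bar> \<le> (3 * K * \<eta>) * (K * (L * \<eta>))"
    proof -
      have "\<bar>x \<bullet> d\<bar> \<le> K * (L * \<eta>)"
        using K(4) DL \<open>0 \<le> K\<close> unfolding D_def
        by (intro order_trans[OF Cauchy_Schwarz_ineq2] mult_mono) auto
      then show ?thesis
        unfolding abs_mult using nts \<open>0 \<le> K\<close> \<open>0 \<le> \<eta>\<close> by (intro mult_mono) auto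
    qed
    moreover have "K * (L * \<eta>\<^sup>2) \<le> K\<^sup>2 * (L * \<eta>\<^sup>2)"
      using power_increasing[OF _ K(1), of 1 2] \<open>1 \<le> L\<close> by (intro mult_right_mono) auto
    ultimately show ?thesis
      unfolding m_def by (simp add: power2_eq_square algebra_simps)
  qed
  have nw: "norm w \<le> 20 * K ^ 3 * L * \<eta>\<^sup>2"
  proof -
    have "norm w \<le> norm ((m / (1 + (norm x)\<^sup>2)) *\<^sub>R x) + norm (transpose A *v (E *v d))
        + norm (transpose E *v (r' - r)) + norm ((t - s) *\<^sub>R d)"
      unfolding w_def by (intro order_trans[OF norm_triangle_ineq] add_mono norm_triangle_ineq4 order_refl)
    also have "\<dots> \<le> 12 * K\<^sup>2 * L * \<eta>\<^sup>2 * K + K * (\<eta> * (L * \<eta>)) + \<eta> * (4 * K * L * \<eta>)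
        + 3 * K * \<eta> * (L * \<eta>)"
    proof (intro add_mono)
      have "\<bar>m / (1 + (norm x)\<^sup>2)\<bar> \<le> \<bar>m\<bar>"
        using frac_le[of "\<bar>m\<bar>" "\<bar>m\<bar>" 1 "1 + (norm x)\<^sup>2"] by (simp add: abs_divide)
      then show "norm ((m / (1 + (norm x)\<^sup>2)) *\<^sub>R x) \<le> 12 * K\<^sup>2 * L * \<eta>\<^sup>2 * K"
        unfolding norm_scaleR using nm K(4) \<open>1 \<le> L\<close> by (intro mult_mono) auto
      show "norm (transpose A *v (E *v d)) \<le> K * (\<eta> * (L * \<eta>))"
        using nAEd DL \<open>0 \<le> K\<close> \<open>0 \<le> \<eta>\<close> by (meson mult_left_mono order_trans)
      have "r' - r = e - A *v d - E *v d"
        by (simp add: res)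
      then show "norm (transpose E *v (r' - r)) \<le> \<eta> * (4 * K * L * \<eta>)"
        using nEt[of "r' - r"] mult_left_mono[OF nr \<open>0 \<le> \<eta>\<close>] by simp
      show "norm ((t - s) *\<^sub>R d) \<le> 3 * K * \<eta> * (L * \<eta>)"
        unfolding norm_scaleR using nts DL \<open>0 \<le> K\<close> \<open>0 \<le> \<eta>\<close>
        by (intro mult_mono) (auto simp: D_def)
    qed
    also have "\<dots> = 12 * (K ^ 3 * (L * \<eta>\<^sup>2)) + 8 * (K * (L * \<eta>\<^sup>2))"
      by (simp add: power2_eq_square power3_eq_cube algebra_simps)
    also have "\<dots> \<le> 12 * (K ^ 3 * (L * \<eta>\<^sup>2)) + 8 * (K ^ 3 * (L * \<eta>\<^sup>2))"
    proof -
      have "K * (L * \<eta>\<^sup>2) \<le> K ^ 3 * (L * \<eta>\<^sup>2)"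
        using power_increasing[of 1 3 K] K(1) \<open>1 \<le> L\<close> by (intro mult_right_mono) auto
      then show ?thesis
        by linarith
    qed
    finally show ?thesis
      by (simp add: mult_ac)
  qed
  \<comment> \<open>Only the first two terms are of first order, so only these are estimated with
    spectral norms; the crude constants affect the remainder alone.\<close>
  have "norm d \<le> norm ((P ** transpose A) *v e') + norm (P *v (transpose E *v r)) + norm (P *v w)"
    by (subst d2) (intro order_trans[OF norm_triangle_ineq] add_mono norm_triangle_ineq order_refl)
  also have "\<dots> \<le> spectral_norm (P ** transpose A) * (norm f + spectral_norm E * norm x)
      + spectral_norm P * (spectral_norm E * norm r) + K * (20 * K ^ 3 * L * \<eta>\<^sup>2)"
  proof (intro add_mono)
    have "norm e' \<le> norm f + spectral_norm E * norm x"
      unfolding e' e_def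
      using norm_triangle_ineq4[of f "E *v x"] spectral_norm_bound[of E x] by linarith
    then show "norm ((P ** transpose A) *v e')
        \<le> spectral_norm (P ** transpose A) * (norm f + spectral_norm E * norm x)"
      by (meson spectral_norm_bound spectral_norm_nonneg mult_left_mono order_trans)
    show "norm (P *v (transpose E *v r)) \<le> spectral_norm P * (spectral_norm E * norm r)"
      by (meson spectral_norm_bound spectral_norm_nonneg mult_left_mono order_trans
          norm_transpose_mult_le)
    show "norm (P *v w) \<le> K * (20 * K ^ 3 * L * \<eta>\<^sup>2)"
      using nP[of w] mult_left_mono[OF nw \<open>0 \<le> K\<close>] by linarith
  qed
  also have "K * (20 * K ^ 3 * L * \<eta>\<^sup>2) = 320 * K ^ 7 * \<eta>\<^sup>2"
    by (simp add: L_def eval_nat_numeral)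
  finally show ?thesis .
qed

text \<open>The asymptotic inequality is expressed by an \<open>\<epsilon>\<close> and a constant
  \<open>C\<close> fixed before the perturbation. Unique existence of the perturbed solution is
  included, so the claim about \<open>\<delta>x\<close> is not vacuous.\<close>

theorem theorem3p1:
  fixes A :: "real^'n^'m" and b r :: "real^'m" and x :: "real^'n"
    and \<sigma> :: real and P :: "real^'n^'n"
  assumes "CARD('m) \<ge> CARD('n)"
    and "\<sigma> = singular_value (append_col A b) (CARD('n) + 1)"
    and "singular_value A CARD('n) > \<sigma>"
    and "tls_solution A b x"
    and "x \<noteq> 0"
    and "r = b - A *v x"
    and "P = matrix_inv (transpose A ** A - \<sigma>\<^sup>2 *\<^sub>R mat 1)"
  shows "\<exists>\<epsilon>>0. \<exists>C. \<forall>(\<delta>A :: real^'n^'m) (\<delta>b :: real^'m).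
    frob_norm (append_col \<delta>A \<delta>b) < \<epsilon> \<longrightarrow>
      (\<exists>!y. tls_solution (A + \<delta>A) (b + \<delta>b) y) \<and>
      (\<forall>\<delta>x. tls_solution (A + \<delta>A) (b + \<delta>b) (x + \<delta>x) \<longrightarrow>
        norm \<delta>x / norm x \<le>
          (norm b / norm x * spectral_norm (P ** transpose A)) * (norm \<delta>b / norm b)
          + (spectral_norm A * norm r / norm x * spectral_norm P
             + spectral_norm A * spectral_norm (P ** transpose A))
            * (spectral_norm \<delta>A / spectral_norm A)
          + C * (frob_norm (append_col \<delta>A \<delta>b))\<^sup>2)"
proof -
  obtain s where "is_tls A b s x"
    using assms(4) tls_solution_iff by blast
  with genericity_gap[OF assms(1-3) this] obtain \<mu> where tls: "is_tls A b (\<sigma>\<^sup>2) x" and "0 \<le> \<sigma>" "\<sigma> < \<mu>"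
    and gap: "\<And>u. \<mu>\<^sup>2 * (norm u)\<^sup>2 \<le> (norm (A *v u))\<^sup>2"
    by metis
  have pos: "\<sigma>\<^sup>2 * (norm u)\<^sup>2 < (norm (A *v u))\<^sup>2" if "u \<noteq> 0" for u
  proof -
    have "\<sigma>\<^sup>2 * (norm u)\<^sup>2 < \<mu>\<^sup>2 * (norm u)\<^sup>2"
      using that \<open>0 \<le> \<sigma>\<close> \<open>\<sigma> < \<mu>\<close> by (intro mult_strict_right_mono power_strict_mono) auto
    then show ?thesis
      using gap[of u] by simp
  qed
  have "invertible (transpose A ** A - \<sigma>\<^sup>2 *\<^sub>R mat 1)"
  proof -
    have "u = 0" if u: "(transpose A ** A - \<sigma>\<^sup>2 *\<^sub>R mat 1) *v u = 0" for u
    proof (rule ccontr)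
      assume "u \<noteq> 0"
      have "(transpose A ** A) *v u = \<sigma>\<^sup>2 *\<^sub>R u"
        using u by (simp add: matrix_vector_mult_diff_rdistrib scaleR_matrix_vector_assoc[symmetric])
      then have "(norm (A *v u))\<^sup>2 = \<sigma>\<^sup>2 * (norm u)\<^sup>2"
        by (metis inner_gram inner_scaleR_right power2_norm_eq_inner)
      then show False
        using pos[OF \<open>u \<noteq> 0\<close>] by simp
    qed
    then show ?thesis
      using invertible_left_inverse matrix_left_invertible_ker by blast
  qed
  then have P: "P ** (transpose A ** A - \<sigma>\<^sup>2 *\<^sub>R mat 1) = mat 1"
    unfolding assms(7) matrix_inv_def invertible_def by (rule someI2_ex) simp
  \<comment> \<open>This and \<open>b \<noteq> 0\<close> make the divisions in the claim genuine, so
    that the relative errors cancel against their prefactors at the end.\<close>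
  have "spectral_norm A \<noteq> 0"
    using pos[OF assms(5)] spectral_norm_eq_0_iff[of A]
    by (metis norm_zero not_less power_zero_numeral zero_le_mult_iff zero_le_power2)
  have "b \<noteq> 0"
  proof
    assume "b = 0"
    then have "\<sigma>\<^sup>2 * (1 + (norm x)\<^sup>2) = (norm (A *v x))\<^sup>2" "\<sigma>\<^sup>2 \<le> 0"
      using is_tls_eq[OF tls] is_tls_le[OF tls, of 0] by simp_all
    then show False
      using pos[OF assms(5)] by simp
  qed
  \<comment> \<open>A single bound for all unperturbed quantities, hence independent of
    \<open>\<delta>A\<close> and \<open>\<delta>b\<close>.\<close>
  define K where "K = 1 + norm A + norm P + norm x + norm r + \<sigma>"
  have K: "1 \<le> K" "norm A \<le> K" "norm P \<le> K" "norm x \<le> K" "norm r \<le> K" "sqrt (\<sigma>\<^sup>2) \<le> K"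
    using \<open>0 \<le> \<sigma>\<close> by (simp_all add: K_def add_nonneg_nonneg)
  \<comment> \<open>The first entry serves unique existence, the second the error bound.\<close>
  define \<epsilon> where "\<epsilon> = min ((\<mu> - \<sigma>) / 2) (1 / (12 * K\<^sup>2))"
  have "\<epsilon> > 0"
    using K(1) \<open>\<sigma> < \<mu>\<close> by (simp add: \<epsilon>_def)
  moreover have "norm \<delta>x / norm x \<le>
      (norm b / norm x * spectral_norm (P ** transpose A)) * (norm \<delta>b / norm b)
      + (spectral_norm A * norm r / norm x * spectral_norm P
         + spectral_norm A * spectral_norm (P ** transpose A)) * (spectral_norm \<delta>A / spectral_norm A)
      + (320 * K ^ 7 / norm x) * (frob_norm (append_col \<delta>A \<delta>b))\<^sup>2"
    if small: "frob_norm (append_col \<delta>A \<delta>b) < \<epsilon>"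
      and sol: "tls_solution (A + \<delta>A) (b + \<delta>b) (x + \<delta>x)" for \<delta>A \<delta>b \<delta>x
  proof -
    obtain t where "is_tls (A + \<delta>A) (b + \<delta>b) t (x + \<delta>x)"
      using sol tls_solution_iff by blast
    moreover have "frob_norm (append_col \<delta>A \<delta>b) \<le> 1 / (12 * K\<^sup>2)"
      using small by (simp add: \<epsilon>_def)
    ultimately have "norm \<delta>x \<le> spectral_norm (P ** transpose A) * (norm \<delta>b + spectral_norm \<delta>A * norm x)
        + spectral_norm P * (spectral_norm \<delta>A * norm r)
        + 320 * K ^ 7 * (frob_norm (append_col \<delta>A \<delta>b))\<^sup>2"
      by (intro tls_perturbation_bound[OF tls _ assms(6) P K frob_norm_eq_norm])
    then have "norm \<delta>x / norm x \<le> (spectral_norm (P ** transpose A) * (norm \<delta>b + spectral_norm \<delta>A * norm x)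
        + spectral_norm P * (spectral_norm \<delta>A * norm r)
        + 320 * K ^ 7 * (frob_norm (append_col \<delta>A \<delta>b))\<^sup>2) / norm x"
      by (rule divide_right_mono) simp
    also have "\<dots> = (norm b / norm x * spectral_norm (P ** transpose A)) * (norm \<delta>b / norm b)
      + (spectral_norm A * norm r / norm x * spectral_norm P
         + spectral_norm A * spectral_norm (P ** transpose A)) * (spectral_norm \<delta>A / spectral_norm A)
      + (320 * K ^ 7 / norm x) * (frob_norm (append_col \<delta>A \<delta>b))\<^sup>2"
      using \<open>b \<noteq> 0\<close> \<open>x \<noteq> 0\<close> \<open>spectral_norm A \<noteq> 0\<close> by (simp add: field_simps)
    finally show ?thesis .
  qed
  moreover have "\<exists>!y. tls_solution (A + \<delta>A) (b + \<delta>b) y"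
    if "frob_norm (append_col \<delta>A \<delta>b) < \<epsilon>" for \<delta>A \<delta>b
    using that perturbed_solution_ex1[OF tls \<open>0 \<le> \<sigma>\<close> gap] by (simp add: \<epsilon>_def frob_norm_eq_norm)
  ultimately show ?thesis
    by blast
qed

end
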